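(* The only periodic points in the big subshift $(\Sigma,\sigma)$ are the two fixed points $a^\infty=\dots aaa\dots$ and $b^\infty=\dots bbb\dots$.
   Context: The Pascal graph has vertex set $\mathscr V=\{(x,y):x,y\in\mathbb Z_{\ge0}\}$ and, for each $(x,y)\in\mathscr V$, one directed edge from $(x,y)$ to $(x+1,y)$ and one to $(x,y+1)$. The root is $(0,0)$. An ordering is a function $\xi:\mathscr V\to\{0,1\}$: for $x,y\ge1$ the edge from $(x-1,y)$ to $(x,y)$ is less than the edge from $(x,y-1)$ to $(x,y)$ if and only if $\xi(x,y)=1$ (the values of $\xi$ at vertices with $x=0$ or $y=0$ play no role; the unique edge entering such a non-root vertex is both minimal and maximal). $X$ is the set of infinite directed paths starting at the root. Distinct paths $\gamma,\eta$ that eventually coincide are compared by $\gamma<\eta$ iff $\gamma_n<\eta_n$, where $n$ is the largest index with $\gamma_n\ne\eta_n$. For a path $\gamma$ not consisting entirely of maximal edges, $T_\xi\gamma$ is the smallest path larger than $\gamma$; $T_\xi^{-1}$ is defined on paths not consisting entirely of minimal edges. The $1$-coding of $\gamma\in X$ is the (possibly one-sided or finite) sequence over $\{a,b\}$ whose $n$-th entry, whenever $T_\xi^n\gamma$ is defined ($n\in\mathbb Z$), is $a$ if the first edge of $T_\xi^n\gamma$ goes from $(0,0)$ to $(1,0)$ and $b$ if it goes to $(0,1)$. For an ordering $\xi$, $\Sigma_\xi\subset\{a,b\}^{\mathbb Z}$ is the set of all two-sided sequences each of whose finite subblocks can be found in the $1$-coding (for $\xi$) of some $\gamma\in X$. $\mathscr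 L(\Omega)$ denotes the set of finite blocks seen in sequences of a subshift $\Omega$. The big subshift $(\Sigma,\sigma)$ is the subshift of $\{a,b\}^{\mathbb Z}$ with $\mathscr L(\Sigma)=\bigcup_\xi\mathscr L(\Sigma_\xi)$, the union over all orderings $\xi$ (equivalently, $\Sigma$ is the closure of $\bigcup_\xi\Sigma_\xi$); $\sigma$ is the shift. *)

theory Defs
  imports "HOL-Analysis.Function_Topology"
begin

type_synonym vertex = "nat \<times> nat"
type_synonym edge = "vertex \<times> vertex"
type_synonym path = "nat \<Rightarrow> edge"

datatype letter = letter_a | letter_b

text \<open>An edge is a pair (source, target); the Pascal graph has no multiple edges.\<close>

definition edges :: "edge set" where
  "edges = {((x, y), (Suc x, y)) | x y. True} \<union> {((x, y), (x, Suc y)) | x y. True}"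

definition paths :: "path set" where
  "paths = {\<gamma>. fst (\<gamma> 0) = (0, 0) \<and> (\<forall>n. \<gamma> n \<in> edges \<and> snd (\<gamma> n) = fst (\<gamma> (Suc n)))}"

text \<open>The values 0 and 1 of an ordering are rendered as False and True.\<close>

type_synonym ordering = "vertex \<Rightarrow> bool"

text \<open>Only two distinct edges with a common target are comparable; the target is then
  (Suc x, Suc y), so the values of the ordering on the boundary of the graph are never used.\<close>

definition edge_less :: "ordering \<Rightarrow> edge \<Rightarrow> edge \<Rightarrow> bool" where
  "edge_less \<xi> e f \<longleftrightarrow> (\<exists>x y.
     let h = ((x, Suc y), (Suc x, Suc y)); v = ((Suc x, y), (Suc x, Suc y)) in
       (\<xi> (Suc x, Suc y) \<and> e = h \<and> f = v) \<or> (\<not> \<xi> (Suc x, Suc y) \<and> e = v \<and> f = h))"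

definition maximal_edge :: "ordering \<Rightarrow> edge \<Rightarrow> bool" where
  "maximal_edge \<xi> e \<longleftrightarrow> \<not> (\<exists>f\<in>edges. edge_less \<xi> e f)"

definition minimal_edge :: "ordering \<Rightarrow> edge \<Rightarrow> bool" where
  "minimal_edge \<xi> e \<longleftrightarrow> \<not> (\<exists>f\<in>edges. edge_less \<xi> f e)"

definition path_less :: "ordering \<Rightarrow> path \<Rightarrow> path \<Rightarrow> bool" where
  "path_less \<xi> \<gamma> \<eta> \<longleftrightarrow> (\<exists>n. \<gamma> n \<noteq> \<eta> n \<and> (\<forall>m>n. \<gamma> m = \<eta> m) \<and> edge_less \<xi> (\<gamma> n) (\<eta> n))"

definition adic_map :: "ordering \<Rightarrow> path \<Rightarrow> path option" where
  "adic_map \<xi> \<gamma> =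
     (if \<forall>n. maximal_edge \<xi> (\<gamma> n) then None
      else Some (THE \<eta>. \<eta> \<in> paths \<and> path_less \<xi> \<gamma> \<eta> \<and>
                   (\<forall>\<zeta>\<in>paths. path_less \<xi> \<gamma> \<zeta> \<longrightarrow> \<eta> = \<zeta> \<or> path_less \<xi> \<eta> \<zeta>)))"

definition adic_map_inv :: "ordering \<Rightarrow> path \<Rightarrow> path option" where
  "adic_map_inv \<xi> \<gamma> =
     (if \<forall>n. minimal_edge \<xi> (\<gamma> n) then None
      else Some (THE \<eta>. \<eta> \<in> paths \<and> adic_map \<xi> \<eta> = Some \<gamma>))"

definition adic_iterate :: "ordering \<Rightarrow> int \<Rightarrow> path \<Rightarrow> path option" where
  "adic_iterate \<xi> n \<gamma> =
     (if n \<ge> 0 then ((\<lambda>p. Option.bind p (adic_map \<xi>)) ^^ nat n) (Some \<gamma>)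
      else ((\<lambda>p. Option.bind p (adic_map_inv \<xi>)) ^^ nat (- n)) (Some \<gamma>))"

text \<open>The 1-coding is a partial two-sided sequence, undefined (None) where the iterate is.\<close>

definition coding :: "ordering \<Rightarrow> path \<Rightarrow> int \<Rightarrow> letter option" where
  "coding \<xi> \<gamma> n =
     map_option (\<lambda>\<eta>. if \<eta> 0 = ((0, 0), (1, 0)) then letter_a else letter_b)
       (adic_iterate \<xi> n \<gamma>)"

definition occurs_in_coding :: "letter list \<Rightarrow> ordering \<Rightarrow> path \<Rightarrow> bool" where
  "occurs_in_coding w \<xi> \<gamma> \<longleftrightarrow>
     (\<exists>k::int. \<forall>i<length w. coding \<xi> \<gamma> (k + int i) = Some (w ! i))"

definition block :: "(int \<Rightarrow> letter) \<Rightarrow> int \<Rightarrow> nat \<Rightarrow> letter list" where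
  "block s k n = map (\<lambda>i. s (k + int i)) [0..<n]"

definition subshift_of_ordering :: "ordering \<Rightarrow> (int \<Rightarrow> letter) set" where
  "subshift_of_ordering \<xi> = {s. \<forall>k n. \<exists>\<gamma>\<in>paths. occurs_in_coding (block s k n) \<xi> \<gamma>}"

definition language :: "(int \<Rightarrow> letter) set \<Rightarrow> letter list set" where
  "language \<Omega> = {block s k n | s k n. s \<in> \<Omega>}"

definition shift :: "(int \<Rightarrow> letter) \<Rightarrow> int \<Rightarrow> letter" where
  "shift s = (\<lambda>n. s (n + 1))"

text \<open>A subshift is determined by its language: it consists of the sequences all of whose
  finite blocks lie in the language. The lemmas below confirm that this set has the
  prescribed language and is the closure of the union in the product topology.\<close>

definition big_subshift :: "(int \<Rightarrow> letter) set" where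
  "big_subshift = {s. \<forall>k n. block s k n \<in> (\<Union>\<xi>. language (subshift_of_ordering \<xi>))}"

definition periodic_points :: "('a \<Rightarrow> 'a) \<Rightarrow> 'a set \<Rightarrow> 'a set" where
  "periodic_points f S = {s \<in> S. \<exists>p>0. (f ^^ p) s = s}"

lemma block_eq_iff: "block s k n = block t l n \<longleftrightarrow> (\<forall>i<n. s (k + int i) = t (l + int i))"
  by (auto simp: block_def)

lemma length_block: "length (block s k n) = n"
  by (simp add: block_def)

lemma language_big_subshift:
  "language big_subshift = (\<Union>\<xi>. language (subshift_of_ordering \<xi>))"
  unfolding big_subshift_def language_def by blast

lemma translate_subshift_of_ordering:
  assumes "s \<in> subshift_of_ordering \<xi>"
  shows "(\<lambda>n. s (n + c)) \<in> subshift_of_ordering \<xi>"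
proof -
  have "block (\<lambda>n. s (n + c)) k n = block s (k + c) n" for k n
    by (simp add: block_eq_iff algebra_simps)
  then show ?thesis using assms by (simp add: subshift_of_ordering_def)
qed

lemma big_subshift_closure:
  "big_subshift = product_topology (\<lambda>_::int. discrete_topology (UNIV :: letter set)) UNIV
     closure_of (\<Union>\<xi>. subshift_of_ordering \<xi>)" (is "_ = ?T closure_of ?U")
proof (intro set_eqI iffI)
  fix s assume s: "s \<in> big_subshift"
  show "s \<in> ?T closure_of ?U"
    unfolding in_closure_of
  proof (intro conjI allI impI)
    show "s \<in> topspace ?T" by simp
  next
    fix V assume "s \<in> V \<and> openin ?T V"
    then obtain W where W: "finite {i. W i \<noteq> (UNIV :: letter set)}"
        "s \<in> Pi\<^sub>E UNIV W" "Pi\<^sub>E UNIV W \<subseteq> V"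
      by (auto simp: openin_product_topology_alt)
    obtain N :: nat where N: "\<And>i. W i \<noteq> UNIV \<Longrightarrow> nat \<bar>i\<bar> \<le> N"
      using W(1) finite_nat_set_iff_bounded_le[of "(\<lambda>i. nat \<bar>i\<bar>) ` {i. W i \<noteq> UNIV}"] by auto
    have "block s (- int N) (2 * N + 1) \<in> (\<Union>\<xi>. language (subshift_of_ordering \<xi>))"
      using s by (simp add: big_subshift_def)
    then obtain \<xi> t k n where t: "t \<in> subshift_of_ordering \<xi>"
        "block s (- int N) (2 * N + 1) = block t k n"
      unfolding language_def by blast
    have n: "n = 2 * N + 1" using t(2) length_block by metis
    define u where "u = (\<lambda>i. t (i + (k + int N)))"
    have u: "u \<in> subshift_of_ordering \<xi>"
      unfolding u_def by (rule translate_subshift_of_ordering[OF t(1)])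
    have "u i = s i" if "nat \<bar>i\<bar> \<le> N" for i
    proof -
      have "nat (i + int N) < 2 * N + 1" using that by linarith
      then have "s (- int N + int (nat (i + int N))) = t (k + int (nat (i + int N)))"
        using t(2) unfolding n block_eq_iff by blast
      moreover have "int (nat (i + int N)) = i + int N" using that by linarith
      ultimately show ?thesis by (simp add: u_def algebra_simps)
    qed
    then have "u i \<in> W i" for i
      using N[of i] W(2) by (cases "W i = UNIV") (auto simp: PiE_iff)
    then have "u \<in> V" using W(3) by auto
    then show "\<exists>y. y \<in> ?U \<and> y \<in> V" using u by blast
  qed
next
  fix s assume s: "s \<in> ?T closure_of ?U"
  show "s \<in> big_subshift"
    unfolding big_subshift_def
  proof (intro CollectI allI)
    fix k n
    define W where "W = (\<lambda>i. if k \<le> i \<and> i < k + int n then {s i} else UNIV)"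
    have "finite {i. W i \<noteq> UNIV}"
      by (rule finite_subset[of _ "{k..<k + int n}"]) (auto simp: W_def)
    then have "openin ?T (Pi\<^sub>E UNIV W)"
      by (auto simp: openin_PiE_gen)
    moreover have "s \<in> Pi\<^sub>E UNIV W" by (auto simp: W_def)
    ultimately obtain t where t: "t \<in> ?U" "t \<in> Pi\<^sub>E UNIV W"
      using s unfolding in_closure_of by blast
    have "t i = s i" if "k \<le> i" "i < k + int n" for i
      using t(2) that by (auto simp: W_def PiE_iff dest: spec[of _ i])
    then have "block s k n = block t k n" by (simp add: block_eq_iff)
    then show "block s k n \<in> (\<Union>\<xi>. language (subshift_of_ordering \<xi>))"
      using t(1) unfolding language_def by blast
  qed
qed

end

theory Submission
  imports Defs
begin

text \<open>Reading the first letters of all finite paths from the root to a vertex \<open>(x, y)\<close>, in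
  increasing order, gives a word \<open>W(x, y)\<close>. It is a single letter on the two axes, and off the axes
  it is \<open>W(x - 1, y)\<close> and \<open>W(x, y - 1)\<close> joined in the order that \<open>\<xi>\<close> prescribes. The adic map moves
  one step forward in such a list as long as the end of the list is not reached, and finitely many
  consecutive iterates of a path pass through a common vertex. So the blocks that occur in
  \<open>1\<close>-codings are exactly the infixes of the words \<open>W(x, y)\<close>: see
  \<open>occurs_in_coding_imp_infix\<close> and \<open>infix_imp_occurs_in_coding\<close>. From here on the problem is one about words.

  For the order that puts \<open>(x - 1, y)\<close> first everywhere, \<open>W(x, 1)\<close> is \<open>b\<close> followed by \<open>x\<close> letters \<open>a\<close>
  and \<open>W(1, y)\<close> is \<open>y\<close> letters \<open>b\<close> followed by \<open>a\<close>. So both constant sequences lie in its subshift.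

  Now let a sequence with period \<open>p\<close> contain both letters, say \<open>c\<close> letters \<open>b\<close> per period with
  \<open>0 < c < p\<close>, and suppose that a very long block of it is an infix of some \<open>W(x, y)\<close>. Cut \<open>W(x, y)\<close>
  into the words of the vertices at level \<open>k = 2 p\<^sup>2 + 1\<close>; all but the two ends of the block is a
  concatenation of such words. Two things are then played against each other.

  \<^item> No word \<open>W(i, k - i)\<close> with \<open>0 < i < k\<close> fits into the sequence
    (\<open>word_not_periodic_block\<close>). The proportion of \<open>b\<close> in it is exactly \<open>(k - i) / k\<close>, whereas blocks of
    the sequence have proportion \<open>c / p\<close> up to an error of order \<open>p\<close> over their length. The two
    fractions differ because \<open>k\<close> is \<open>1\<close> modulo \<open>p\<close>, so \<open>c k\<close> is not a multiple of \<open>p\<close>; and \<open>k\<close> is large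
    enough for the error not to bridge the difference.
  \<^item> Hence only the words of the two axis vertices of level \<open>k\<close> remain, which are the single letters \<open>a\<close>
    and \<open>b\<close>. But between two occurrences of the vertex on the \<open>b\<close>-axis with the vertex on the
    \<open>a\<close>-axis in between there is always a vertex off the axes
    (\<open>level_word_interior_between\<close>), and three periods of the sequence contain \<open>b\<close>, \<open>a\<close>, \<open>b\<close>
    in this order.\<close>

section \<open>The coding words of the vertices\<close>

text \<open>The first letters of the finite paths from the root to \<open>(x, y)\<close> in increasing order: paths are compared
  at their last difference, so those that end with the smaller of the two incoming edges come first.
  At the root, where the only path is empty, the letter is arbitrary but the length \<open>1\<close> is right.\<close>
fun word :: "ordering \<Rightarrow> nat \<Rightarrow> nat \<Rightarrow> letter list" where
  "word \<xi> x 0 = [letter_a]"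
| "word \<xi> 0 (Suc y) = [letter_b]"
| "word \<xi> (Suc x) (Suc y) =
     (if \<xi> (Suc x, Suc y) then word \<xi> x (Suc y) @ word \<xi> (Suc x) y
      else word \<xi> (Suc x) y @ word \<xi> x (Suc y))"

abbreviation vertex_word :: "ordering \<Rightarrow> vertex \<Rightarrow> letter list" where
  "vertex_word \<xi> v \<equiv> word \<xi> (fst v) (snd v)"

abbreviation width :: "ordering \<Rightarrow> vertex \<Rightarrow> nat" where
  "width \<xi> v \<equiv> length (vertex_word \<xi> v)"

lemma word_0_left: "0 < y \<Longrightarrow> word \<xi> 0 y = [letter_b]"
  by (cases y) auto

lemma length_word_0_left [simp]: "length (word \<xi> 0 y) = 1"
  by (cases y) auto

lemma word_nonempty: "word \<xi> x y \<noteq> []"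
  by (induction \<xi> x y rule: word.induct) auto

section \<open>The rank of a path among the paths with the same tail\<close>

text \<open>The number of finite paths that enter the target of \<open>e\<close> through an edge smaller than \<open>e\<close>.\<close>
definition offset :: "ordering \<Rightarrow> edge \<Rightarrow> nat" where
  "offset \<xi> e = (case e of ((u, v), (x, y)) \<Rightarrow>
     if x = 0 \<or> y = 0 then 0
     else if u = x then (if \<xi> (x, y) then length (word \<xi> (x - 1) y) else 0)
     else (if \<xi> (x, y) then 0 else length (word \<xi> x (y - 1))))"

text \<open>The position of the initial segment \<open>\<gamma> 0, \<dots>, \<gamma> (n - 1)\<close> in the increasing list of the finite
  paths from the root to the vertex \<open>fst (\<gamma> n)\<close>.\<close>
definition rank :: "ordering \<Rightarrow> path \<Rightarrow> nat \<Rightarrow> nat" where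
  "rank \<xi> \<gamma> n = (\<Sum>i<n. offset \<xi> (\<gamma> i))"

lemma rank_0 [simp]: "rank \<xi> \<gamma> 0 = 0"
  and rank_Suc [simp]: "rank \<xi> \<gamma> (Suc n) = rank \<xi> \<gamma> n + offset \<xi> (\<gamma> n)"
  by (simp_all add: rank_def)

lemma edges_cases:
  assumes "e \<in> edges"
  obtains x where "e = ((x, 0), (Suc x, 0))"
  | y where "e = ((0, y), (0, Suc y))"
  | x y where "e = ((x, Suc y), (Suc x, Suc y))"
  | x y where "e = ((Suc x, y), (Suc x, Suc y))"
proof -
  from assms consider x y where "e = ((x, y), (Suc x, y))" | x y where "e = ((x, y), (x, Suc y))"
    by (auto simp: edges_def)
  then show thesis
  proof cases
    case (1 x y) then show thesis using that(1,3) by (cases y) auto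
  next
    case (2 x y) then show thesis using that(2,4) by (cases x) auto
  qed
qed

lemma offset_add_width_le: "e \<in> edges \<Longrightarrow> offset \<xi> e + width \<xi> (fst e) \<le> width \<xi> (snd e)"
  by (erule edges_cases) (auto simp: offset_def word_0_left)

lemma edge_less_offset:
  assumes "edge_less \<xi> e f"
  shows "snd e = snd f" "offset \<xi> f = offset \<xi> e + width \<xi> (fst e)"
  using assms by (auto simp: edge_less_def offset_def Let_def)

lemma edge_less_edges: "edge_less \<xi> e f \<Longrightarrow> e \<in> edges \<and> f \<in> edges"
  by (auto simp: edge_less_def edges_def Let_def)

lemma edge_less_into_interior [simp]:
  "edge_less \<xi> ((x, Suc y), (Suc x, Suc y)) ((Suc x, y), (Suc x, Suc y)) \<longleftrightarrow> \<xi> (Suc x, Suc y)"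
  "edge_less \<xi> ((Suc x, y), (Suc x, Suc y)) ((x, Suc y), (Suc x, Suc y)) \<longleftrightarrow> \<not> \<xi> (Suc x, Suc y)"
  by (auto simp: edge_less_def)

lemma edge_less_linear:
  assumes "e \<in> edges" "f \<in> edges" "snd e = snd f" "e \<noteq> f"
  shows "edge_less \<xi> e f \<or> edge_less \<xi> f e"
  using assms by (elim edges_cases) simp_all

text \<open>The finite paths into a vertex are split between its incoming edges, so every position belongs to one edge.\<close>
lemma edge_with_offset:
  assumes "e \<in> edges" "r < width \<xi> (snd e)"
  obtains f where "f \<in> edges" "snd f = snd e" "offset \<xi> f \<le> r" "r < offset \<xi> f + width \<xi> (fst f)"
proof (cases "fst (snd e) = 0 \<or> snd (snd e) = 0")
  case True
  then show thesis using assms that[of e]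
    by (auto elim!: edges_cases simp: offset_def word_0_left)
next
  case False
  then obtain x y where e: "snd e = (Suc x, Suc y)"
    by (metis not0_implies_Suc prod.collapse)
  let ?h = "((x, Suc y), (Suc x, Suc y))" and ?v = "((Suc x, y), (Suc x, Suc y))"
  have "?h \<in> edges" "?v \<in> edges" by (auto simp: edges_def)
  moreover have "(offset \<xi> ?h \<le> r \<and> r < offset \<xi> ?h + width \<xi> (fst ?h)) \<or>
      (offset \<xi> ?v \<le> r \<and> r < offset \<xi> ?v + width \<xi> (fst ?v))"
    using assms(2) e by (auto simp: offset_def split: if_splits)
  ultimately show thesis using e that by (metis snd_conv)
qed

lemma vertex_word_nth_offset:
  assumes "e \<in> edges" "fst e \<noteq> (0, 0)" "i < width \<xi> (fst e)"
  shows "vertex_word \<xi> (snd e) ! (offset \<xi> e + i) = vertex_word \<xi> (fst e) ! i"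
  using assms by (auto elim!: edges_cases simp: offset_def nth_append word_0_left)

lemma paths_root: "\<gamma> \<in> paths \<Longrightarrow> fst (\<gamma> 0) = (0, 0)"
  and paths_edge: "\<gamma> \<in> paths \<Longrightarrow> \<gamma> n \<in> edges"
  and paths_joined: "\<gamma> \<in> paths \<Longrightarrow> snd (\<gamma> n) = fst (\<gamma> (Suc n))"
  by (auto simp: paths_def)

lemma edge_level: "e \<in> edges \<Longrightarrow> fst (snd e) + snd (snd e) = Suc (fst (fst e) + snd (fst e))"
  by (auto simp: edges_def)

lemma paths_level: "\<gamma> \<in> paths \<Longrightarrow> fst (fst (\<gamma> n)) + snd (fst (\<gamma> n)) = n"
proof (induction n)
  case 0 then show ?case by (simp add: paths_def)
next
  case (Suc n)
  then show ?case using edge_level[OF paths_edge, of \<gamma> n] paths_joined[of \<gamma> n] by simp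
qed

lemma rank_less_width: "\<gamma> \<in> paths \<Longrightarrow> rank \<xi> \<gamma> n < width \<xi> (fst (\<gamma> n))"
proof (induction n)
  case 0 then show ?case by (simp add: paths_def)
next
  case (Suc n)
  then show ?case
    using offset_add_width_le[OF paths_edge, of \<gamma> \<xi> n] paths_joined[of \<gamma> n] by simp
qed

definition first_letter :: "path \<Rightarrow> letter" where
  "first_letter \<gamma> = (if \<gamma> 0 = ((0, 0), (1, 0)) then letter_a else letter_b)"

text \<open>By the recursion for words, following \<open>\<gamma>\<close> up one edge moves the entry at its rank to the entry
  at its new rank. So the entry never changes from level \<open>1\<close> on, where it is the first letter.\<close>
lemma vertex_word_nth_rank:
  assumes "\<gamma> \<in> paths"
  shows "vertex_word \<xi> (fst (\<gamma> (Suc n))) ! rank \<xi> \<gamma> (Suc n) = first_letter \<gamma>"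
proof (induction n)
  case 0
  have "\<gamma> 0 = ((0, 0), (Suc 0, 0)) \<or> \<gamma> 0 = ((0, 0), (0, Suc 0))"
    using paths_edge[OF assms, of 0] paths_root[OF assms] by (auto simp: edges_def)
  then show ?case
    by (elim disjE)
      (simp_all add: first_letter_def offset_def flip: paths_joined[OF assms, of 0])
next
  case (Suc n)
  note e = paths_edge[OF assms, of "Suc n"] paths_joined[OF assms, of "Suc n"]
  have "fst (\<gamma> (Suc n)) \<noteq> (0, 0)" using paths_level[OF assms, of "Suc n"] by auto
  from vertex_word_nth_offset[OF e(1) this rank_less_width[OF assms, of \<xi> "Suc n"]] Suc e(2)
  show ?case by (simp add: add.commute)
qed

lemma path_through_vertex:
  obtains \<gamma> where "\<gamma> \<in> paths" "fst (\<gamma> (x + y)) = (x, y)"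
proof
  let ?g = "\<lambda>i. if i < x then ((i, 0), (Suc i, 0)) else ((x, i - x), (x, Suc i - x))"
  show "?g \<in> paths" by (auto simp: paths_def edges_def Suc_diff_le)
  show "fst (?g (x + y)) = (x, y)" by simp
qed

text \<open>Every position is taken by a path with the given tail. Going down from level \<open>n\<close>, the position
  determines the next edge, and below that edge a position in the word of its source remains.\<close>
lemma path_with_rank:
  assumes "\<gamma> \<in> paths" "r < width \<xi> (fst (\<gamma> n))"
  shows "\<exists>\<eta>\<in>paths. (\<forall>m\<ge>n. \<eta> m = \<gamma> m) \<and> rank \<xi> \<eta> n = r"
  using assms
proof (induction n arbitrary: \<gamma> r)
  case 0
  then show ?case by (auto simp: paths_def)
next
  case (Suc n)
  note \<gamma> = paths_edge[OF Suc.prems(1)] paths_joined[OF Suc.prems(1)]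
  obtain f where f: "f \<in> edges" "snd f = snd (\<gamma> n)" "offset \<xi> f \<le> r"
      "r < offset \<xi> f + width \<xi> (fst f)"
    using edge_with_offset[of "\<gamma> n" r \<xi>] \<gamma> Suc.prems(2) by metis
  obtain x y where xy: "fst f = (x, y)" by (cases "fst f") auto
  have n: "x + y = n"
    using edge_level[OF f(1)] f(2) xy paths_level[OF Suc.prems(1), of "Suc n"] \<gamma>(2)[of n]
    by simp
  obtain \<gamma>0 where \<gamma>0: "\<gamma>0 \<in> paths" "fst (\<gamma>0 n) = fst f"
    using path_through_vertex[of x y] xy n by metis
  \<comment> \<open>The edge below level \<open>Suc n\<close> is replaced by \<open>f\<close>, completed to a path by any route to its source.\<close>
  define \<zeta> where "\<zeta> = (\<lambda>m. if m < n then \<gamma>0 m else if m = n then f else \<gamma> m)"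
  have "\<zeta> m \<in> edges \<and> snd (\<zeta> m) = fst (\<zeta> (Suc m))" for m
  proof -
    show ?thesis
      using paths_edge[OF \<gamma>0(1), of m] paths_joined[OF \<gamma>0(1), of m] \<gamma>[of m] f(1,2) \<gamma>0(2) unfolding \<zeta>_def
      by (cases "Suc m = n"; cases "m = n") auto
  qed
  moreover have "fst (\<zeta> 0) = (0, 0)"
    using \<gamma>0 xy n by (cases n) (auto simp: \<zeta>_def paths_def)
  ultimately have \<zeta>: "\<zeta> \<in> paths" by (simp add: paths_def)
  have "r - offset \<xi> f < width \<xi> (fst (\<zeta> n))" using f(3,4) by (simp add: \<zeta>_def)
  from Suc.IH[OF \<zeta> this] obtain \<eta>
    where \<eta>: "\<eta> \<in> paths" "\<forall>m\<ge>n. \<eta> m = \<zeta> m" "rank \<xi> \<eta> n = r - offset \<xi> f" by blast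
  have "\<forall>m\<ge>Suc n. \<eta> m = \<gamma> m" "rank \<xi> \<eta> (Suc n) = r"
    using \<eta>(2,3) f(3) by (auto simp: \<zeta>_def)
  then show ?case using \<eta>(1) by blast
qed

text \<open>Along a common tail the ranks grow by the same offsets, so the level at which two ranks are compared does not matter.\<close>
lemma rank_difference:
  assumes "\<forall>m\<ge>n. \<gamma> m = \<eta> m" "n \<le> m"
  shows "rank \<xi> \<gamma> m + rank \<xi> \<eta> n = rank \<xi> \<eta> m + rank \<xi> \<gamma> n"
  using assms(2)
proof (induction m rule: dec_induct)
  case (step m)
  then have "\<gamma> m = \<eta> m" using assms(1) by simp
  with step show ?case by simp
qed simp

text \<open>Just above the last difference, the larger path has all paths through the source of the smaller
  edge before it, and the smaller path is one of them; higher up the difference of the ranks is constant.\<close>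
lemma rank_mono:
  assumes "\<gamma> \<in> paths" "\<eta> \<in> paths" "\<forall>m\<ge>n. \<gamma> m = \<eta> m" "path_less \<xi> \<gamma> \<eta>"
  shows "rank \<xi> \<gamma> n < rank \<xi> \<eta> n"
proof -
  obtain j where j: "\<gamma> j \<noteq> \<eta> j" "\<forall>m>j. \<gamma> m = \<eta> m" "edge_less \<xi> (\<gamma> j) (\<eta> j)"
    using assms(4) by (auto simp: path_less_def)
  have "j < n" using j(1) assms(3) by (metis not_less)
  have "rank \<xi> \<gamma> (Suc j) < rank \<xi> \<eta> (Suc j)"
    using edge_less_offset(2)[OF j(3)] rank_less_width[OF assms(1), of \<xi> j] by simp
  then show ?thesis using rank_difference[of "Suc j" \<gamma> \<eta> n \<xi>] j(2) \<open>j < n\<close> by auto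
qed

lemma path_less_linear:
  assumes "\<gamma> \<in> paths" "\<eta> \<in> paths" "\<forall>m\<ge>n. \<gamma> m = \<eta> m"
  shows "\<gamma> = \<eta> \<or> path_less \<xi> \<gamma> \<eta> \<or> path_less \<xi> \<eta> \<gamma>"
proof (cases "\<gamma> = \<eta>")
  case False
  define j where "j = Max {i. \<gamma> i \<noteq> \<eta> i}"
  have fin: "finite {i. \<gamma> i \<noteq> \<eta> i}"
    by (rule finite_subset[of _ "{..<n}"]) (use assms(3) in \<open>auto simp: not_less[symmetric]\<close>)
  have "{i. \<gamma> i \<noteq> \<eta> i} \<noteq> {}" using False by auto
  with fin have j: "\<gamma> j \<noteq> \<eta> j" using Max_in unfolding j_def by blast
  have above: "\<forall>m>j. \<gamma> m = \<eta> m" using Max_ge[OF fin] unfolding j_def by fastforce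
  then have "snd (\<gamma> j) = snd (\<eta> j)"
    using paths_joined[OF assms(1), of j] paths_joined[OF assms(2), of j] by simp
  then have "edge_less \<xi> (\<gamma> j) (\<eta> j) \<or> edge_less \<xi> (\<eta> j) (\<gamma> j)"
    using edge_less_linear paths_edge assms(1,2) j by blast
  with j above show ?thesis unfolding path_less_def by metis
qed simp

lemma rank_inj:
  assumes "\<gamma> \<in> paths" "\<eta> \<in> paths" "\<forall>m\<ge>n. \<gamma> m = \<eta> m" "rank \<xi> \<gamma> n = rank \<xi> \<eta> n"
  shows "\<gamma> = \<eta>"
  using path_less_linear[OF assms(1-3)] rank_mono[OF assms(1-3)] rank_mono[OF assms(2,1), of n \<xi>] assms(3,4)
  by fastforce

lemma path_less_asym:
  assumes "\<gamma> \<in> paths" "\<eta> \<in> paths" "path_less \<xi> \<gamma> \<eta>"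
  shows "\<not> path_less \<xi> \<eta> \<gamma>"
proof -
  obtain n where "\<forall>m>n. \<gamma> m = \<eta> m" using assms(3) by (auto simp: path_less_def)
  then have "\<forall>m\<ge>Suc n. \<gamma> m = \<eta> m" "\<forall>m\<ge>Suc n. \<eta> m = \<gamma> m" by auto
  from rank_mono[OF assms(1,2) this(1), of \<xi>] rank_mono[OF assms(2,1) this(2), of \<xi>] assms(3)
  show ?thesis by linarith
qed

text \<open>The adic map raises the rank by one. A path \<open>\<zeta>\<close> above \<open>\<gamma>\<close> either has the same tail from
  level \<open>n\<close>, and then its rank is at least that of \<open>\<eta>\<close>, or last differs from \<open>\<gamma>\<close> at an
  index at least \<open>n\<close>, where \<open>\<eta>\<close> agrees with \<open>\<gamma>\<close>; so it lies above \<open>\<eta>\<close> too.\<close>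
lemma adic_map_eqI:
  assumes "\<gamma> \<in> paths" "\<eta> \<in> paths" "\<forall>m\<ge>n. \<eta> m = \<gamma> m" "rank \<xi> \<eta> n = rank \<xi> \<gamma> n + 1"
  shows "adic_map \<xi> \<gamma> = Some \<eta>"
proof -
  have eq: "\<forall>m\<ge>n. \<gamma> m = \<eta> m" using assms(3) by auto
  have less: "path_less \<xi> \<gamma> \<eta>"
    using path_less_linear[OF assms(1,2) eq, of \<xi>] rank_mono[OF assms(2,1,3), of \<xi>] assms(4)
    by fastforce
  have least: "\<eta> = \<zeta> \<or> path_less \<xi> \<eta> \<zeta>" if \<zeta>: "\<zeta> \<in> paths" "path_less \<xi> \<gamma> \<zeta>" for \<zeta>
  proof -
    obtain j where j: "\<gamma> j \<noteq> \<zeta> j" "\<forall>m>j. \<gamma> m = \<zeta> m" "edge_less \<xi> (\<gamma> j) (\<zeta> j)"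
      using \<zeta>(2) by (auto simp: path_less_def)
    show ?thesis
    proof (cases "j < n")
      case True
      then have tail: "\<forall>m\<ge>n. \<gamma> m = \<zeta> m" using j(2) by simp
      then have tail': "\<forall>m\<ge>n. \<zeta> m = \<eta> m" "\<forall>m\<ge>n. \<eta> m = \<zeta> m" using eq by simp_all
      have "\<not> path_less \<xi> \<zeta> \<eta>"
        using rank_mono[OF assms(1) \<zeta>(1) tail \<zeta>(2)] rank_mono[OF \<zeta>(1) assms(2) tail'(1), of \<xi>]
          assms(4) by linarith
      then show ?thesis using path_less_linear[OF assms(2) \<zeta>(1) tail'(2), of \<xi>] by blast
    next
      case False
      then have "\<eta> m = \<gamma> m" if "m \<ge> j" for m using assms(3) that by auto
      then have "path_less \<xi> \<eta> \<zeta>"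
        unfolding path_less_def using j by (intro exI[of _ j]) auto
      then show ?thesis ..
    qed
  qed
  have "(THE \<eta>. \<eta> \<in> paths \<and> path_less \<xi> \<gamma> \<eta> \<and>
          (\<forall>\<zeta>\<in>paths. path_less \<xi> \<gamma> \<zeta> \<longrightarrow> \<eta> = \<zeta> \<or> path_less \<xi> \<eta> \<zeta>)) = \<eta>"
    using assms(2) less least path_less_asym by (intro the_equality) blast+
  moreover have "\<exists>j. \<not> maximal_edge \<xi> (\<gamma> j)"
    using less edge_less_edges unfolding path_less_def maximal_edge_def by blast
  ultimately show ?thesis by (simp add: adic_map_def)
qed

text \<open>Above a non-maximal edge of \<open>\<gamma>\<close> the rank of \<open>\<gamma>\<close> is not the last position, so the next position
  is taken by a path, which must be the successor.\<close>
lemma adic_map_SomeD: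
  assumes "\<gamma> \<in> paths" "adic_map \<xi> \<gamma> = Some \<eta>"
  shows "\<eta> \<in> paths \<and> (\<exists>n. (\<forall>m\<ge>n. \<eta> m = \<gamma> m) \<and> rank \<xi> \<eta> n = rank \<xi> \<gamma> n + 1)"
proof -
  obtain j where "\<not> maximal_edge \<xi> (\<gamma> j)"
    using assms(2) by (auto simp: adic_map_def split: if_splits)
  then obtain f where f: "f \<in> edges" "edge_less \<xi> (\<gamma> j) f" by (auto simp: maximal_edge_def)
  have "rank \<xi> \<gamma> (Suc j) + 1 < width \<xi> (fst (\<gamma> (Suc j)))"
    using paths_joined[OF assms(1), of j] edge_less_offset[OF f(2)] offset_add_width_le[OF f(1), of \<xi>]
      rank_less_width[OF assms(1), of \<xi> j] word_nonempty[of \<xi> "fst (fst f)" "snd (fst f)"]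
    by (simp flip: length_greater_0_conv)
  then obtain \<zeta> where "\<zeta> \<in> paths" "\<forall>m\<ge>Suc j. \<zeta> m = \<gamma> m" "rank \<xi> \<zeta> (Suc j) = rank \<xi> \<gamma> (Suc j) + 1"
    using path_with_rank[OF assms(1)] by blast
  with adic_map_eqI[OF assms(1) this] assms(2) show ?thesis by auto
qed

text \<open>The preimage is the path at the preceding position. It is unique, since a preimage
  shares a tail with \<open>\<gamma>\<close> and its rank there is one less.\<close>
lemma adic_map_inv_SomeD:
  assumes "\<gamma> \<in> paths" "adic_map_inv \<xi> \<gamma> = Some \<eta>"
  shows "\<eta> \<in> paths \<and> adic_map \<xi> \<eta> = Some \<gamma>"
proof -
  obtain j where "\<not> minimal_edge \<xi> (\<gamma> j)"
    using assms(2) by (auto simp: adic_map_inv_def split: if_splits)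
  then obtain f where f: "edge_less \<xi> f (\<gamma> j)" by (auto simp: minimal_edge_def)
  have pos: "0 < rank \<xi> \<gamma> (Suc j)"
    using edge_less_offset(2)[OF f] word_nonempty[of \<xi> "fst (fst f)" "snd (fst f)"]
    by (simp flip: length_greater_0_conv)
  have "rank \<xi> \<gamma> (Suc j) - 1 < width \<xi> (fst (\<gamma> (Suc j)))"
    using rank_less_width[OF assms(1), of \<xi> "Suc j"] by linarith
  then obtain \<zeta> where \<zeta>: "\<zeta> \<in> paths" "\<forall>m\<ge>Suc j. \<zeta> m = \<gamma> m"
      "rank \<xi> \<zeta> (Suc j) = rank \<xi> \<gamma> (Suc j) - 1"
    using path_with_rank[OF assms(1)] by blast
  then have map: "adic_map \<xi> \<zeta> = Some \<gamma>"
    using pos assms(1) by (intro adic_map_eqI[of _ _ "Suc j"]) auto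
  have "\<zeta>' = \<zeta>" if \<zeta>': "\<zeta>' \<in> paths" "adic_map \<xi> \<zeta>' = Some \<gamma>" for \<zeta>'
  proof -
    obtain n n' where n: "\<forall>m\<ge>n. \<gamma> m = \<zeta> m" "rank \<xi> \<gamma> n = rank \<xi> \<zeta> n + 1"
      and n': "\<forall>m\<ge>n'. \<gamma> m = \<zeta>' m" "rank \<xi> \<gamma> n' = rank \<xi> \<zeta>' n' + 1"
      using adic_map_SomeD[OF \<zeta>(1) map] adic_map_SomeD[OF \<zeta>'] by blast
    have "rank \<xi> \<zeta>' (max n n') = rank \<xi> \<zeta> (max n n')"
      using rank_difference[OF n(1), of "max n n'" \<xi>] rank_difference[OF n'(1), of "max n n'" \<xi>]
        n(2) n'(2) by simp
    moreover have "\<forall>m\<ge>max n n'. \<zeta>' m = \<zeta> m" using n(1) n'(1) by auto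
    ultimately show ?thesis using rank_inj \<zeta>'(1) \<zeta>(1) by blast
  qed
  then have "(THE \<eta>. \<eta> \<in> paths \<and> adic_map \<xi> \<eta> = Some \<gamma>) = \<zeta>"
    using \<zeta>(1) map by (intro the_equality) blast+
  then have "\<eta> = \<zeta>" using assms(2) by (auto simp: adic_map_inv_def split: if_splits)
  then show ?thesis using \<zeta>(1) map by simp
qed

lemma adic_iterate_0: "adic_iterate \<xi> 0 \<gamma> = Some \<gamma>"
  by (simp add: adic_iterate_def)

lemma adic_iterate_Suc_nonneg:
  assumes "0 \<le> n"
  shows "adic_iterate \<xi> (n + 1) \<gamma> = Option.bind (adic_iterate \<xi> n \<gamma>) (adic_map \<xi>)"
proof -
  have "nat (n + 1) = Suc (nat n)" using assms by simp
  then show ?thesis using assms by (simp add: adic_iterate_def)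
qed

lemma adic_iterate_pred_nonpos:
  assumes "n \<le> 0"
  shows "adic_iterate \<xi> (n - 1) \<gamma> = Option.bind (adic_iterate \<xi> n \<gamma>) (adic_map_inv \<xi>)"
proof -
  have "nat (- (n - 1)) = Suc (nat (- n))" using assms by simp
  then show ?thesis using assms by (cases "n = 0") (simp_all add: adic_iterate_def)
qed

lemma adic_iterate_paths:
  assumes "\<gamma> \<in> paths" "adic_iterate \<xi> n \<gamma> = Some \<eta>"
  shows "\<eta> \<in> paths"
  using assms(2)
proof (induction n arbitrary: \<eta> rule: int_induct[of _ 0])
  case base
  then show ?case using assms(1) by (simp add: adic_iterate_0)
next
  case (step1 i)
  then show ?case using adic_map_SomeD
    by (fastforce simp: adic_iterate_Suc_nonneg bind_eq_Some_conv)
next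
  case (step2 i)
  then show ?case using adic_map_inv_SomeD
    by (fastforce simp: adic_iterate_pred_nonpos bind_eq_Some_conv)
qed

lemma adic_map_adic_iterate:
  assumes "\<gamma> \<in> paths" "adic_iterate \<xi> n \<gamma> = Some \<eta>" "adic_iterate \<xi> (n + 1) \<gamma> = Some \<zeta>"
  shows "adic_map \<xi> \<eta> = Some \<zeta>"
proof (cases "0 \<le> n")
  case True
  then show ?thesis using assms by (simp add: adic_iterate_Suc_nonneg)
next
  case False
  then have "adic_map_inv \<xi> \<zeta> = Some \<eta>"
    using assms(2,3) adic_iterate_pred_nonpos[of "n + 1" \<xi> \<gamma>] by simp
  then show ?thesis using adic_map_inv_SomeD adic_iterate_paths[OF assms(1,3)] by blast
qed

text \<open>Consecutive iterates share tails, so finitely many of them share one tail from some level on. There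
  their ranks are consecutive, and the letters stand side by side in the word of their common vertex.\<close>
lemma occurs_in_coding_imp_infix:
  assumes "\<gamma> \<in> paths" "occurs_in_coding w \<xi> \<gamma>"
  shows "\<exists>x y p q. word \<xi> x y = p @ w @ q \<and> 0 < x + y"
proof (cases "w = []")
  case True
  then have "word \<xi> 1 0 = [] @ w @ [letter_a]" by simp
  then show ?thesis by fastforce
next
  case False
  obtain k where k: "\<forall>i<length w. coding \<xi> \<gamma> (k + int i) = Some (w ! i)"
    using assms(2) by (auto simp: occurs_in_coding_def)
  define \<eta> where "\<eta> i = the (adic_iterate \<xi> (k + int i) \<gamma>)" for i
  have it: "adic_iterate \<xi> (k + int i) \<gamma> = Some (\<eta> i)" and letter: "first_letter (\<eta> i) = w ! i"
    if "i < length w" for i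
    using k[rule_format, OF that] by (auto simp: coding_def \<eta>_def first_letter_def)
  have paths: "\<eta> i \<in> paths" if "i < length w" for i
    using adic_iterate_paths[OF assms(1) it[OF that]] .
  have "\<exists>n. \<forall>i<l. (\<forall>m\<ge>n. \<eta> i m = \<eta> 0 m) \<and> rank \<xi> (\<eta> i) n = rank \<xi> (\<eta> 0) n + i"
    if "l \<le> length w" for l
    using that
  proof (induction l)
    case 0 show ?case by simp
  next
    case (Suc l)
    then obtain n where n: "\<forall>m\<ge>n. \<eta> i m = \<eta> 0 m" "rank \<xi> (\<eta> i) n = rank \<xi> (\<eta> 0) n + i"
      if "i < l" for i by auto
    show ?case
    proof (cases l)
      case 0 then show ?thesis by (intro exI[of _ n]) auto
    next
      case (Suc l')
      have "adic_map \<xi> (\<eta> l') = Some (\<eta> l)"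
        using Suc \<open>Suc l \<le> length w\<close> adic_map_adic_iterate[OF assms(1) it[of l']] it[of l]
        by (simp add: add_ac)
      then obtain n' where n': "\<forall>m\<ge>n'. \<eta> l m = \<eta> l' m" "rank \<xi> (\<eta> l) n' = rank \<xi> (\<eta> l') n' + 1"
        using adic_map_SomeD paths[of l'] Suc \<open>Suc l \<le> length w\<close> by (metis Suc_le_lessD Suc_lessD)
      let ?n = "max n n'"
      have below: "rank \<xi> (\<eta> i) ?n = rank \<xi> (\<eta> 0) ?n + i" if "i < l" for i
        using rank_difference[OF n(1)[OF that], of ?n \<xi>] n(2)[OF that] by simp
      have "rank \<xi> (\<eta> l) ?n = rank \<xi> (\<eta> l') ?n + 1"
        using rank_difference[OF n'(1), of ?n \<xi>] n'(2) by simp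
      with below[of l'] Suc have "rank \<xi> (\<eta> l) ?n = rank \<xi> (\<eta> 0) ?n + l" by simp
      with below have "rank \<xi> (\<eta> i) ?n = rank \<xi> (\<eta> 0) ?n + i" if "i < Suc l" for i
        using that less_Suc_eq by metis
      moreover have "\<eta> i m = \<eta> 0 m" if "i < Suc l" "?n \<le> m" for i m
        using n(1)[of i, rule_format, of m] n(1)[of l', rule_format, of m] n'(1)[rule_format, of m]
          that Suc by (cases "i = l") simp_all
      ultimately show ?thesis by blast
    qed
  qed
  then obtain n where n: "\<And>i. i < length w \<Longrightarrow> \<forall>m\<ge>n. \<eta> i m = \<eta> 0 m"
      "\<And>i. i < length w \<Longrightarrow> rank \<xi> (\<eta> i) n = rank \<xi> (\<eta> 0) n + i"
    by blast
  \<comment> \<open>One level higher than \<open>n\<close>, since at level \<open>0\<close> the word does not show the first letter.\<close>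
  define r where "r = rank \<xi> (\<eta> 0) (Suc n)"
  define v where "v = fst (\<eta> 0 (Suc n))"
  have nth: "r + i < width \<xi> v \<and> vertex_word \<xi> v ! (r + i) = w ! i" if "i < length w" for i
  proof -
    have "rank \<xi> (\<eta> i) (Suc n) = r + i" "fst (\<eta> i (Suc n)) = v"
      using n[OF that] by (auto simp: r_def v_def)
    then show ?thesis
      using rank_less_width[OF paths[OF that], of \<xi> "Suc n"]
        vertex_word_nth_rank[OF paths[OF that], of \<xi> n] letter[OF that] by auto
  qed
  from nth[of "length w - 1"] False have len: "r + length w \<le> width \<xi> v" by (cases w) auto
  have "take (length w) (drop r (vertex_word \<xi> v)) = w"
    using nth len by (intro nth_equalityI) auto
  then have "vertex_word \<xi> v = take r (vertex_word \<xi> v) @ w @ drop (length w) (drop r (vertex_word \<xi> v))"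
    by (metis append_take_drop_id)
  moreover have "0 < fst v + snd v"
    using paths_level[OF paths, of 0 "Suc n"] False by (simp add: v_def)
  ultimately show ?thesis by (intro exI conjI)
qed

lemma infix_imp_occurs_in_coding:
  assumes "word \<xi> x y = p @ w @ q" "0 < x + y"
  shows "\<exists>\<gamma>\<in>paths. occurs_in_coding w \<xi> \<gamma>"
proof -
  obtain \<delta> where \<delta>: "\<delta> \<in> paths" "fst (\<delta> (x + y)) = (x, y)" using path_through_vertex[of x y] by blast
  show ?thesis
  proof (cases "w = []")
    case True
    then show ?thesis using \<delta>(1) by (auto simp: occurs_in_coding_def)
  next
    case False
    let ?n = "x + y"
    obtain \<gamma> where \<gamma>: "\<gamma> \<in> paths" "\<forall>m\<ge>?n. \<gamma> m = \<delta> m" "rank \<xi> \<gamma> ?n = length p"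
      using path_with_rank[OF \<delta>(1), of "length p" \<xi> ?n] \<delta>(2) assms(1) False by auto
    have step: "\<exists>\<eta>\<in>paths. (\<forall>m\<ge>?n. \<eta> m = \<delta> m) \<and> rank \<xi> \<eta> ?n = length p + i \<and>
        adic_iterate \<xi> (int i) \<gamma> = Some \<eta>" if "i < length w" for i
      using that
    proof (induction i)
      case 0
      then show ?case using \<gamma> by (intro bexI[of _ \<gamma>]) (auto simp: adic_iterate_0)
    next
      case (Suc i)
      then obtain \<eta> where \<eta>: "\<eta> \<in> paths" "\<forall>m\<ge>?n. \<eta> m = \<delta> m" "rank \<xi> \<eta> ?n = length p + i"
          "adic_iterate \<xi> (int i) \<gamma> = Some \<eta>" by auto
      obtain \<zeta> where \<zeta>: "\<zeta> \<in> paths" "\<forall>m\<ge>?n. \<zeta> m = \<eta> m" "rank \<xi> \<zeta> ?n = length p + Suc i"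
        using path_with_rank[OF \<eta>(1), of "length p + Suc i" \<xi> ?n] \<eta>(2) \<delta>(2) assms(1) Suc.prems
        by auto
      have "adic_map \<xi> \<eta> = Some \<zeta>"
        using adic_map_eqI[OF \<eta>(1) \<zeta>(1,2), of \<xi>] \<zeta>(3) \<eta>(3) by simp
      then have "adic_iterate \<xi> (int (Suc i)) \<gamma> = Some \<zeta>"
        using adic_iterate_Suc_nonneg[of "int i" \<xi> \<gamma>] \<eta>(4) by (simp add: add.commute)
      then show ?case using \<zeta> \<eta>(2) by auto
    qed
    have "coding \<xi> \<gamma> (0 + int i) = Some (w ! i)" if i: "i < length w" for i
    proof -
      obtain \<eta> where \<eta>: "\<eta> \<in> paths" "\<forall>m\<ge>?n. \<eta> m = \<delta> m" "rank \<xi> \<eta> ?n = length p + i"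
          "adic_iterate \<xi> (int i) \<gamma> = Some \<eta>" using step[OF i] by auto
      have n: "Suc (?n - 1) = ?n" using assms(2) by simp
      have "word \<xi> x y ! (length p + i) = first_letter \<eta>"
        using vertex_word_nth_rank[OF \<eta>(1), of \<xi> "?n - 1", unfolded n] \<eta>(2,3) \<delta>(2) by simp
      then show ?thesis using \<eta>(4) i assms(1) by (simp add: coding_def first_letter_def nth_append)
    qed
    then show ?thesis using \<gamma>(1) unfolding occurs_in_coding_def by blast
  qed
qed

section \<open>Letter counts in the coding words\<close>

lemma length_word: "length (word \<xi> x y) = (x + y) choose x"
proof (induction \<xi> x y rule: word.induct)
  case (3 \<xi> x y)
  then show ?case by (simp add: add_ac)
qed simp_all

lemma count_word: "count_list (word \<xi> x (Suc y)) letter_b = (x + y) choose x"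
proof (induction x arbitrary: y)
  case (Suc x)
  note IH = Suc
  show ?case
  proof (induction y)
    case 0
    show ?case using IH[of 0] by simp
  next
    case (Suc y)
    show ?case using IH[of "Suc y"] Suc by (simp add: add_ac)
  qed
qed simp

text \<open>Away from the root, \<open>b\<close> has proportion exactly \<open>y / (x + y)\<close> in the word of \<open>(x, y)\<close>, whatever the ordering:
  of the paths to \<open>(x, y)\<close>, those that start with a vertical step are the arrangements of the other
  \<open>x + y - 1\<close> steps.\<close>
lemma letter_frequency: "(x + y) * count_list (word \<xi> x y) letter_b = y * length (word \<xi> x y)"
proof (cases y)
  case (Suc z)
  have "Suc (x + z) * (x + z choose z) = Suc z * (Suc (x + z) choose Suc z)"
    using Suc_times_binomial_eq[of "x + z" z] by (simp add: mult.commute)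
  moreover have "(x + z choose z) = (x + z choose x)" "(Suc (x + z) choose Suc z) = (Suc (x + z) choose x)"
    using binomial_symmetric[of x "x + z"] binomial_symmetric[of x "Suc (x + z)"]
    by (simp_all add: Suc_diff_le)
  ultimately show ?thesis using Suc by (simp add: length_word count_word)
qed simp

lemma choose_two_le_choose:
  assumes "2 \<le> x" "2 \<le> y"
  shows "(x + y) choose 2 \<le> (x + y) choose x"
proof (cases "x \<le> y")
  case True
  then show ?thesis using binomial_mono[of 2 x "x + y"] assms by simp
next
  case False
  then show ?thesis using binomial_mono[of 2 y "x + y"] binomial_symmetric[of x "x + y"] assms by simp
qed

section \<open>Letter counts in the blocks of a periodic sequence\<close>

lemma block_append: "block s t (m + n) = block s t m @ block s (t + int m) n"
  by (rule nth_equalityI) (auto simp: block_def nth_append)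

lemma block_infix:
  assumes "block s t n = p @ v @ q"
  shows "v = block s (t + int (length p)) (length v)"
proof (rule nth_equalityI)
  fix i assume i: "i < length v"
  have n: "n = length p + length v + length q"
    using assms length_block[of s t n] by (metis add.assoc length_append)
  have "v ! i = (p @ v @ q) ! (length p + i)" using i by (simp add: nth_append)
  also have "\<dots> = block s t n ! (length p + i)" by (simp add: assms)
  finally show "v ! i = block s (t + int (length p)) (length v) ! i"
    using i n by (simp add: block_def add.assoc)
qed (simp add: length_block)

lemma periodic_add_multiple:
  fixes s :: "int \<Rightarrow> 'a" and p z n :: int
  assumes "\<And>n. s (n + p) = s n"
  shows "s (n + z * p) = s n"
proof (induction z rule: int_induct[of _ 0])
  case (step1 i)
  then show ?case using assms[of "n + i * p"] by (simp add: algebra_simps)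
next
  case (step2 i)
  then show ?case using assms[of "n + (i - 1) * p"] by (simp add: algebra_simps)
qed simp

text \<open>Shifting a window of length \<open>p\<close> by one drops a letter and adds the same letter.\<close>
lemma count_period:
  fixes t u :: int
  assumes per: "\<And>n. s (n + int p) = s n"
  shows "count_list (block s t p) x = count_list (block s u p) x"
proof -
  have step: "count_list (block s (v + 1) p) x = count_list (block s v p) x" for v
  proof -
    have "block s v (1 + p) = block s v (p + 1)" by (simp add: add.commute)
    then have "[s v] @ block s (v + 1) p = block s v p @ [s v]"
      unfolding block_append using per[of v] by (simp add: block_def)
    from arg_cong[OF this, of "\<lambda>w. count_list w x"] show ?thesis by (simp split: if_splits)
  qed
  have "count_list (block s v p) x = count_list (block s 0 p) x" for v
    by (induction v rule: int_induct[of _ 0]) (use step step[of "_ - 1"] in simp_all)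
  then show ?thesis by metis
qed

text \<open>A block of length \<open>n\<close> contains about \<open>c n / p\<close> copies of a letter that occurs \<open>c\<close> times per period. Cutting off
  a full period leaves the discrepancy unchanged, so only blocks shorter than a period matter.\<close>
lemma count_block_discrepancy:
  assumes per: "\<And>n. s (n + int p) = s n" and "0 < p"
  shows "\<bar>int p * int (count_list (block s t n) x) - int (count_list (block s 0 p) x) * int n\<bar> < int p * int p"
proof (induction n arbitrary: t rule: less_induct)
  case (less n)
  let ?c = "count_list (block s 0 p) x"
  show ?case
  proof (cases "n < p")
    case True
    have "count_list (block s t n) x \<le> n" "?c \<le> p"
      using count_le_length length_block by metis+
    then have "p * count_list (block s t n) x \<le> p * n" "?c * n \<le> p * n" "p * n < p * p"
      using True \<open>0 < p\<close> by (simp_all add: mult_right_mono)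
    then have "int p * int (count_list (block s t n) x) < int p * int p" "int ?c * int n < int p * int p"
      unfolding of_nat_mult[symmetric] by linarith+
    moreover have "0 \<le> int p * int (count_list (block s t n) x)" "0 \<le> int ?c * int n" by simp_all
    ultimately show ?thesis by linarith
  next
    case False
    define m where "m = n - p"
    have n: "n = p + m" and "m < n" using False \<open>0 < p\<close> by (simp_all add: m_def)
    have "count_list (block s t n) x = ?c + count_list (block s (t + int p) m) x"
      unfolding n block_append using count_period[where s = s and p = p, OF per, where t = t and u = 0 and x = x] by simp
    then show ?thesis using less.IH[OF \<open>m < n\<close>, of "t + int p"] by (simp add: n algebra_simps)
  qed
qed

lemma count_period_bounds:
  assumes per: "\<And>n. s (n + int p) = s n" and "0 < p" and "s u = letter_a" "s v = letter_b"
  shows "0 < count_list (block s 0 p) letter_b" "count_list (block s 0 p) letter_b < p"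
proof -
  obtain q where p: "p = 1 + q" using \<open>0 < p\<close> by (metis Suc_eq_plus1_left gr0_implies_Suc)
  have "count_list (block s u p) letter_b \<le> q"
    unfolding p block_append using assms(3) count_le_length[of "block s (u + 1) q"]
    by (simp add: block_def)
  then show "count_list (block s 0 p) letter_b < p"
    using count_period[where s = s and p = p, OF per, where t = 0 and u = u and x = letter_b] p by simp
  have "0 < count_list (block s v p) letter_b"
    unfolding p block_append using assms(4) by (simp add: block_def)
  then show "0 < count_list (block s 0 p) letter_b"
    using count_period[where s = s and p = p, OF per, where t = 0 and u = v and x = letter_b] by simp
qed

text \<open>Let \<open>k = x + y\<close>, let \<open>n\<close> be the length of the word and \<open>c\<close> the number of letters \<open>b\<close> in a period. As the
  word has \<open>y n / k\<close> letters \<open>b\<close>, its discrepancy \<open>d\<close> satisfies \<open>k d = n e\<close> with \<open>e = p y - c k\<close>, and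
  \<open>\<bar>d\<bar> < p\<^sup>2\<close> by periodicity. Since \<open>k\<close> is \<open>1\<close> modulo \<open>p\<close> and \<open>0 < c < p\<close>, the integer \<open>e\<close> is
  not \<open>0\<close>. If \<open>x\<close> and \<open>y\<close> are at least \<open>2\<close>, then \<open>n\<close> is at least \<open>k choose 2\<close>, which equals \<open>k p\<^sup>2\<close> for this \<open>k\<close>,
  and this is too long for so small a \<open>d\<close>. If one of them is \<open>1\<close>, then \<open>n\<close> is only \<open>k\<close>, but \<open>e\<close> itself is large.\<close>
lemma word_not_periodic_block:
  assumes per: "\<And>n. s (n + int p) = s n" and "0 < p" and "s u = letter_a" "s v = letter_b"
    and k: "x + y = 2 * p * p + 1" and "0 < x" "0 < y"
  shows "word \<xi> x y \<noteq> block s t n"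
proof
  assume eq: "word \<xi> x y = block s t n"
  define k c where "k = int (x + y)" and "c = int (count_list (block s 0 p) letter_b)"
  have c: "0 < c" "c < int p"
    using count_period_bounds[where s = s and p = p, OF per assms(2-4)] by (simp_all add: c_def)
  have n: "n = (x + y) choose x" using eq length_word[of \<xi> x y] length_block[of s t n] by simp
  have kp: "k = 2 * int p * int p + 1" unfolding k_def k by simp
  have freq: "k * int (count_list (block s t n) letter_b) = int y * int n"
    using letter_frequency[of x y \<xi>] eq length_block[of s t n]
    unfolding k_def of_nat_mult[symmetric] by simp
  define d where "d = int p * int (count_list (block s t n) letter_b) - c * int n"
  define e where "e = int p * int y - c * k"
  have d: "\<bar>d\<bar> < int p * int p"
    using count_block_discrepancy[where s = s and p = p, OF per \<open>0 < p\<close>, where t = t and n = n and x = letter_b]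
    by (simp add: d_def c_def)
  have "k * d = int n * e"
    unfolding d_def e_def using arg_cong[OF freq, of "\<lambda>z. int p * z"] by (simp add: algebra_simps)
  then have prod: "k * \<bar>d\<bar> = int n * \<bar>e\<bar>"
    by (metis abs_mult abs_of_nat k_def)
  have "0 < k" using assms(6) by (simp add: k_def)
  show False
  proof (cases "2 \<le> x \<and> 2 \<le> y")
    case True
    have "e \<noteq> 0"
    proof
      assume "e = 0"
      then have "c = int p * (int y - 2 * c * int p)"
        unfolding e_def kp by (simp add: algebra_simps)
      then have "int p dvd c" by (metis dvd_triv_left)
      then show False using c zdvd_not_zless by blast
    qed
    then have "int n \<le> int n * \<bar>e\<bar>" using mult_left_mono[of 1 "\<bar>e\<bar>" "int n"] by simp
    then have "int n \<le> k * \<bar>d\<bar>" using prod by simp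
    moreover have "k * \<bar>d\<bar> < k * (int p * int p)" using d \<open>0 < k\<close> by simp
    moreover have "k * (int p * int p) \<le> int n"
    proof -
      have "(x + y) choose 2 = (x + y) * (p * p)"
        using k by (simp add: choose_two)
      then have "(x + y) * (p * p) \<le> n" using choose_two_le_choose[of x y] True n by simp
      then have "int ((x + y) * (p * p)) \<le> int n" by (simp only: of_nat_le_iff)
      then show ?thesis by (simp add: k_def)
    qed
    ultimately show False by linarith
  next
    case False
    then consider "x = 1" | "y = 1" using assms(6,7) by linarith
    then have nk: "int n = k"
    proof cases
      case 1 then show ?thesis by (simp add: n k_def)
    next
      case 2 then show ?thesis by (simp add: n k_def)
    qed
    then have "\<bar>d\<bar> = \<bar>e\<bar>" using prod \<open>0 < k\<close> by simp
    then have small: "\<bar>e\<bar> < int p * int p" using d by simp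
    have pp: "int p \<le> int p * int p" using \<open>0 < p\<close> by (simp add: mult_le_cancel_left1)
    have "k \<le> c * k" using c(1) \<open>0 < k\<close> by (simp add: mult_le_cancel_right1)
    have "k \<le> (int p - c) * k" using c(2) \<open>0 < k\<close> by (simp add: mult_le_cancel_right1)
    from False assms(6,7) consider "x = 1" | "y = 1" by linarith
    then show False
    proof cases
      case 1
      then have y: "int y = k - 1" by (simp add: k_def)
      have "e = (int p - c) * k - int p" unfolding e_def y by (simp add: algebra_simps)
      then show False using \<open>k \<le> (int p - c) * k\<close> small pp kp by linarith
    next
      case 2
      then have "e = int p - c * k" by (simp add: e_def)
      then show False using \<open>k \<le> c * k\<close> small pp kp by linarith
    qed
  qed
qed

section \<open>Decomposition of the coding words at a fixed level\<close>

text \<open>The word of \<open>(x, y)\<close> factors into words of vertices at level \<open>k\<close>; this lists the vertices, with \<open>i\<close>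
  standing for \<open>(i, k - i)\<close>. An axis vertex above level \<open>k\<close> is reached through the axis only, so its list
  is the single number \<open>k\<close> or \<open>0\<close>. The values below level \<open>k\<close> have no meaning.\<close>
fun level_word :: "ordering \<Rightarrow> nat \<Rightarrow> nat \<Rightarrow> nat \<Rightarrow> nat list" where
  "level_word \<xi> k x 0 = [k]"
| "level_word \<xi> k 0 (Suc y) = [0]"
| "level_word \<xi> k (Suc x) (Suc y) =
     (if Suc x + Suc y \<le> k then [Suc x]
      else if \<xi> (Suc x, Suc y) then level_word \<xi> k x (Suc y) @ level_word \<xi> k (Suc x) y
      else level_word \<xi> k (Suc x) y @ level_word \<xi> k x (Suc y))"

lemma word_eq_concat_level_word:
  assumes "0 < k" "k \<le> x + y"
  shows "word \<xi> x y = concat (map (\<lambda>i. word \<xi> i (k - i)) (level_word \<xi> k x y))"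
  using assms
proof (induction \<xi> k x y rule: level_word.induct)
  case (3 \<xi> k x y)
  show ?case
  proof (cases "Suc x + Suc y \<le> k")
    case True
    then have "k - Suc x = Suc y" using "3.prems" by simp
    with True show ?thesis by simp
  next
    case False
    then show ?thesis using 3 by (cases "\<xi> (Suc x, Suc y)") simp_all
  qed
qed (simp_all add: word_0_left)

lemma level_word_le: "k \<le> x + y \<Longrightarrow> i \<in> set (level_word \<xi> k x y) \<Longrightarrow> i \<le> k"
  by (induction \<xi> k x y rule: level_word.induct) (auto split: if_splits)

lemma level_word_interior:
  assumes "2 \<le> k" "k \<le> x + y" "0 < x" "0 < y"
  shows "\<exists>i\<in>set (level_word \<xi> k x y). 0 < i \<and> i < k"
  using assms
proof (induction \<xi> k x y rule: level_word.induct)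
  case (3 \<xi> k x y)
  show ?case
  proof (cases "Suc x + Suc y \<le> k")
    case False
    then consider "0 < x" | "0 < y" using "3.prems"(1) by linarith
    then show ?thesis using 3 False by cases (auto 0 3)
  qed simp
qed simp_all

text \<open>A path to \<open>(x, 1)\<close> has made at most one vertical step, so it misses \<open>(0, k)\<close> when \<open>k\<close> is at least \<open>2\<close>.\<close>
lemma level_word_next_to_axis:
  assumes "2 \<le> k" "k \<le> x + 1"
  shows "0 \<notin> set (level_word \<xi> k x (Suc 0))"
  using assms
proof (induction x)
  case (Suc x)
  then show ?case by (cases "Suc (Suc x) \<le> k") auto
qed simp

text \<open>The property wanted is \<open>interior_between\<close>, that \<open>0\<close>, \<open>k\<close>, \<open>0\<close> in this order are separated by a
  number strictly between \<open>0\<close> and \<open>k\<close>. In a concatenation the three positions may be split between the two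
  factors, which calls for one-sided versions: such a number occurs somewhere to the right of the \<open>0\<close>
  in a pair \<open>0\<close>, \<open>k\<close>, and somewhere to the left of the \<open>0\<close> in a pair \<open>k\<close>, \<open>0\<close>.\<close>
definition interior_after :: "nat \<Rightarrow> nat list \<Rightarrow> bool" where
  "interior_after k w \<longleftrightarrow> (\<forall>i j. i < j \<and> j < length w \<and> w ! i = 0 \<and> w ! j = k \<longrightarrow>
     (\<exists>m. i < m \<and> m < length w \<and> 0 < w ! m \<and> w ! m < k))"

definition interior_before :: "nat \<Rightarrow> nat list \<Rightarrow> bool" where
  "interior_before k w \<longleftrightarrow> (\<forall>j l. j < l \<and> l < length w \<and> w ! j = k \<and> w ! l = 0 \<longrightarrow>
     (\<exists>m<l. 0 < w ! m \<and> w ! m < k))"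

definition interior_between :: "nat \<Rightarrow> nat list \<Rightarrow> bool" where
  "interior_between k w \<longleftrightarrow>
     (\<forall>i j l. i < j \<and> j < l \<and> l < length w \<and> w ! i = 0 \<and> w ! j = k \<and> w ! l = 0 \<longrightarrow>
       (\<exists>m. i < m \<and> m < l \<and> 0 < w ! m \<and> w ! m < k))"

lemma interior_after_append:
  assumes "interior_after k v" "interior_after k w"
    and "0 \<in> set v \<Longrightarrow> k \<in> set w \<Longrightarrow> \<exists>m\<in>set w. 0 < m \<and> m < k"
  shows "interior_after k (v @ w)"
  unfolding interior_after_def
proof (intro allI impI)
  fix i j
  assume *: "i < j \<and> j < length (v @ w) \<and> (v @ w) ! i = 0 \<and> (v @ w) ! j = k"
  consider "j < length v" | "i < length v" "length v \<le> j" | "length v \<le> i" by linarith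
  then show "\<exists>m. i < m \<and> m < length (v @ w) \<and> 0 < (v @ w) ! m \<and> (v @ w) ! m < k"
  proof cases
    case 1
    then have "i < j \<and> j < length v \<and> v ! i = 0 \<and> v ! j = k"
      using * by (auto simp: nth_append)
    then obtain m where "i < m" "m < length v" "0 < v ! m" "v ! m < k"
      using assms(1) unfolding interior_after_def by blast
    then show ?thesis by (intro exI[of _ m]) (simp add: nth_append)
  next
    case 2
    then have "v ! i = 0" "w ! (j - length v) = k" "j - length v < length w"
      using * by (auto simp: nth_append)
    then have "0 \<in> set v" "k \<in> set w" using 2 nth_mem by metis+
    then obtain m where "m < length w" "0 < w ! m" "w ! m < k"
      using assms(3) by (auto simp: in_set_conv_nth)
    then show ?thesis using 2 by (intro exI[of _ "length v + m"]) (simp add: nth_append)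
  next
    case 3
    then have "i - length v < j - length v \<and> j - length v < length w \<and>
        w ! (i - length v) = 0 \<and> w ! (j - length v) = k"
      using * by (auto simp: nth_append)
    then obtain m where "i - length v < m" "m < length w" "0 < w ! m" "w ! m < k"
      using assms(2) unfolding interior_after_def by blast
    then show ?thesis using 3 by (intro exI[of _ "length v + m"]) (auto simp: nth_append)
  qed
qed

lemma interior_before_append:
  assumes "interior_before k v" "interior_before k w"
    and "k \<in> set v \<Longrightarrow> 0 \<in> set w \<Longrightarrow> \<exists>m\<in>set v. 0 < m \<and> m < k"
  shows "interior_before k (v @ w)"
  unfolding interior_before_def
proof (intro allI impI)
  fix j l
  assume *: "j < l \<and> l < length (v @ w) \<and> (v @ w) ! j = k \<and> (v @ w) ! l = 0"
  consider "l < length v" | "j < length v" "length v \<le> l" | "length v \<le> j" by linarith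
  then show "\<exists>m<l. 0 < (v @ w) ! m \<and> (v @ w) ! m < k"
  proof cases
    case 1
    then have "j < l \<and> l < length v \<and> v ! j = k \<and> v ! l = 0"
      using * by (auto simp: nth_append)
    then obtain m where "m < l" "0 < v ! m" "v ! m < k"
      using assms(1) unfolding interior_before_def by blast
    then show ?thesis using 1 by (intro exI[of _ m]) (simp add: nth_append)
  next
    case 2
    then have "v ! j = k" "w ! (l - length v) = 0" "l - length v < length w"
      using * by (auto simp: nth_append)
    then have "k \<in> set v" "0 \<in> set w" using 2 nth_mem by metis+
    then obtain m where "m < length v" "0 < v ! m" "v ! m < k"
      using assms(3) by (auto simp: in_set_conv_nth)
    then show ?thesis using 2 by (intro exI[of _ m]) (simp add: nth_append)
  next
    case 3
    then have "j - length v < l - length v \<and> l - length v < length w \<and>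
        w ! (j - length v) = k \<and> w ! (l - length v) = 0"
      using * by (auto simp: nth_append)
    then obtain m where "m < l - length v" "0 < w ! m" "w ! m < k"
      using assms(2) unfolding interior_before_def by blast
    then show ?thesis by (intro exI[of _ "length v + m"]) (auto simp: nth_append)
  qed
qed

lemma interior_between_append:
  assumes "interior_between k v" "interior_between k w" "interior_after k v" "interior_before k w"
  shows "interior_between k (v @ w)"
  unfolding interior_between_def
proof (intro allI impI)
  fix i j l
  assume *: "i < j \<and> j < l \<and> l < length (v @ w) \<and>
    (v @ w) ! i = 0 \<and> (v @ w) ! j = k \<and> (v @ w) ! l = 0"
  consider "l < length v" | "j < length v" "length v \<le> l" | "i < length v" "length v \<le> j"
    | "length v \<le> i" by linarith
  then show "\<exists>m. i < m \<and> m < l \<and> 0 < (v @ w) ! m \<and> (v @ w) ! m < k"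
  proof cases
    case 1
    then have "i < j \<and> j < l \<and> l < length v \<and> v ! i = 0 \<and> v ! j = k \<and> v ! l = 0"
      using * by (auto simp: nth_append)
    then obtain m where "i < m" "m < l" "0 < v ! m" "v ! m < k"
      using assms(1) unfolding interior_between_def by blast
    then show ?thesis using 1 by (intro exI[of _ m]) (simp add: nth_append)
  next
    case 2
    then have "i < j \<and> j < length v \<and> v ! i = 0 \<and> v ! j = k"
      using * by (auto simp: nth_append)
    then obtain m where "i < m" "m < length v" "0 < v ! m" "v ! m < k"
      using assms(3) unfolding interior_after_def by blast
    then show ?thesis using 2 by (intro exI[of _ m]) (simp add: nth_append)
  next
    case 3
    then have "j - length v < l - length v \<and> l - length v < length w \<and>
        w ! (j - length v) = k \<and> w ! (l - length v) = 0"
      using * by (auto simp: nth_append)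
    then obtain m where "m < l - length v" "0 < w ! m" "w ! m < k"
      using assms(4) unfolding interior_before_def by blast
    then show ?thesis using 3 by (intro exI[of _ "length v + m"]) (auto simp: nth_append)
  next
    case 4
    then have "i - length v < j - length v \<and> j - length v < l - length v \<and> l - length v < length w \<and>
        w ! (i - length v) = 0 \<and> w ! (j - length v) = k \<and> w ! (l - length v) = 0"
      using * by (auto simp: nth_append)
    then obtain m where "i - length v < m" "m < l - length v" "0 < w ! m" "w ! m < k"
      using assms(2) unfolding interior_between_def by blast
    then show ?thesis using 4 by (intro exI[of _ "length v + m"]) (auto simp: nth_append)
  qed
qed

lemma interior_singleton:
  "interior_after k [i]" "interior_before k [i]" "interior_between k [i]"
  by (simp_all add: interior_after_def interior_before_def interior_between_def)

text \<open>The lists of two neighbouring vertices meet the side conditions for joining them in either order. A list without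
  interior numbers belongs to an axis vertex. If this is \<open>(Suc x, 0)\<close>, the other list is that of a vertex
  at height \<open>1\<close> and has no \<open>0\<close>; if it is \<open>(0, Suc y)\<close>, its only entry is \<open>0\<close> and not \<open>k\<close>.\<close>
lemma level_word_junction:
  assumes "2 \<le> k" "k < Suc x + Suc y"
  shows "0 \<in> set (level_word \<xi> k x (Suc y)) \<Longrightarrow> k \<in> set (level_word \<xi> k (Suc x) y) \<Longrightarrow>
      \<exists>m\<in>set (level_word \<xi> k (Suc x) y). 0 < m \<and> m < k"
    and "k \<in> set (level_word \<xi> k x (Suc y)) \<Longrightarrow>
      \<exists>m\<in>set (level_word \<xi> k x (Suc y)). 0 < m \<and> m < k"
proof -
  assume 0: "0 \<in> set (level_word \<xi> k x (Suc y))"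
  have "0 < y"
  proof (rule ccontr)
    assume "\<not> 0 < y"
    then show False using 0 level_word_next_to_axis[of k x \<xi>] assms by simp
  qed
  then show "\<exists>m\<in>set (level_word \<xi> k (Suc x) y). 0 < m \<and> m < k"
    using assms by (intro level_word_interior) auto
next
  assume "k \<in> set (level_word \<xi> k x (Suc y))"
  then have "0 < x" using assms by (cases x) auto
  then show "\<exists>m\<in>set (level_word \<xi> k x (Suc y)). 0 < m \<and> m < k"
    using assms by (intro level_word_interior) auto
qed

lemma level_word_interior_between:
  assumes "2 \<le> k" "k \<le> x + y"
  shows "interior_after k (level_word \<xi> k x y) \<and> interior_before k (level_word \<xi> k x y) \<and>
    interior_between k (level_word \<xi> k x y)"
  using assms
proof (induction \<xi> k x y rule: level_word.induct)
  case (3 \<xi> k x y)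
  show ?case
  proof (cases "Suc x + Suc y \<le> k")
    case True
    then show ?thesis by (simp add: interior_singleton)
  next
    case False
    then have k: "k < Suc x + Suc y" by simp
    note junction = level_word_junction[OF "3.prems"(1) k, of \<xi>]
    show ?thesis
    proof (cases "\<xi> (Suc x, Suc y)")
      case True
      have "interior_after k (level_word \<xi> k x (Suc y)) \<and> interior_before k (level_word \<xi> k x (Suc y)) \<and>
          interior_between k (level_word \<xi> k x (Suc y))"
        "interior_after k (level_word \<xi> k (Suc x) y) \<and> interior_before k (level_word \<xi> k (Suc x) y) \<and>
          interior_between k (level_word \<xi> k (Suc x) y)"
        using "3.IH"(1,2)[OF False True "3.prems"(1)] k by simp_all
      then have "interior_after k (level_word \<xi> k x (Suc y) @ level_word \<xi> k (Suc x) y)"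
        "interior_before k (level_word \<xi> k x (Suc y) @ level_word \<xi> k (Suc x) y)"
        "interior_between k (level_word \<xi> k x (Suc y) @ level_word \<xi> k (Suc x) y)"
        using junction
        by (blast intro: interior_after_append interior_before_append interior_between_append)+
      then show ?thesis using True False by simp
    next
      case not: False
      have "interior_after k (level_word \<xi> k x (Suc y)) \<and> interior_before k (level_word \<xi> k x (Suc y)) \<and>
          interior_between k (level_word \<xi> k x (Suc y))"
        "interior_after k (level_word \<xi> k (Suc x) y) \<and> interior_before k (level_word \<xi> k (Suc x) y) \<and>
          interior_between k (level_word \<xi> k (Suc x) y)"
        using "3.IH"(3,4)[OF False not "3.prems"(1)] k by simp_all
      then have "interior_after k (level_word \<xi> k (Suc x) y @ level_word \<xi> k x (Suc y))"
        "interior_before k (level_word \<xi> k (Suc x) y @ level_word \<xi> k x (Suc y))"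
        "interior_between k (level_word \<xi> k (Suc x) y @ level_word \<xi> k x (Suc y))"
        using junction
        by (blast intro: interior_after_append interior_before_append interior_between_append)+
      then show ?thesis using not False by simp
    qed
  qed
qed (simp_all add: interior_singleton)

section \<open>Long blocks of a periodic sequence\<close>

text \<open>A suffix of a concatenation starts with an incomplete factor at most, and dually for
  prefixes below.\<close>
lemma suffix_of_concat:
  assumes "concat (map f ds) = p @ r" "\<And>d. d \<in> set ds \<Longrightarrow> length (f d) \<le> m"
  shows "\<exists>d1 d2 p'. ds = d1 @ d2 \<and> r = p' @ concat (map f d2) \<and> length p' \<le> m"
  using assms
proof (induction ds arbitrary: p)
  case Nil
  then show ?case by auto
next
  case (Cons d ds)
  from Cons.prems(1) have "f d @ concat (map f ds) = p @ r" by simp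
  then consider p' where "p = f d @ p'" "concat (map f ds) = p' @ r"
    | p' where "f d = p @ p'" "r = p' @ concat (map f ds)"
    unfolding append_eq_append_conv2 by blast
  then show ?case
  proof cases
    case 1
    then obtain d1 d2 q where "ds = d1 @ d2" "r = q @ concat (map f d2)" "length q \<le> m"
      using Cons.IH[of p'] Cons.prems(2) by auto
    then show ?thesis by (intro exI[of _ "d # d1"] exI[of _ d2] exI[of _ q]) simp
  next
    case 2
    then have "length p' \<le> m" using Cons.prems(2)[of d] by simp
    then show ?thesis using 2 by (intro exI[of _ "[d]"] exI[of _ ds] exI[of _ p']) simp
  qed
qed

lemma prefix_of_concat:
  assumes "concat (map f ds) = r @ q" "\<And>d. d \<in> set ds \<Longrightarrow> length (f d) \<le> m"
  shows "\<exists>d1 d2 q'. ds = d1 @ d2 \<and> r = concat (map f d1) @ q' \<and> length q' \<le> m"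
  using assms
proof (induction ds arbitrary: r)
  case Nil
  then show ?case by auto
next
  case (Cons d ds)
  from Cons.prems(1) have "f d @ concat (map f ds) = r @ q" by simp
  then consider r' where "r = f d @ r'" "concat (map f ds) = r' @ q"
    | r' where "f d = r @ r'"
    unfolding append_eq_append_conv2 by blast
  then show ?case
  proof cases
    case 1
    then obtain d1 d2 q' where "ds = d1 @ d2" "r' = concat (map f d1) @ q'" "length q' \<le> m"
      using Cons.IH[of r'] Cons.prems(2) by auto
    then show ?thesis using 1 by (intro exI[of _ "d # d1"] exI[of _ d2] exI[of _ q']) simp
  next
    case 2
    then have "length r \<le> m" using Cons.prems(2)[of d] by simp
    then show ?thesis by (intro exI[of _ "[]"] exI[of _ "d # ds"] exI[of _ r]) simp
  qed
qed

lemma infix_of_concat: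
  assumes "concat (map f ds) = p @ w @ q" "\<And>d. d \<in> set ds \<Longrightarrow> length (f d) \<le> m" "m < length w"
  obtains d1 d2 d3 p' q' where "ds = d1 @ d2 @ d3" "w = p' @ concat (map f d2) @ q'"
    "length p' \<le> m" "length q' \<le> m"
proof -
  obtain d1 ds' p' where 1: "ds = d1 @ ds'" "w @ q = p' @ concat (map f ds')" "length p' \<le> m"
    using suffix_of_concat[OF assms(1,2)] by blast
  then obtain w' where w': "w = p' @ w'" "concat (map f ds') = w' @ q"
    using assms(3) by (auto simp: append_eq_append_conv2)
  obtain d2 d3 q' where "ds' = d2 @ d3" "w' = concat (map f d2) @ q'" "length q' \<le> m"
    using prefix_of_concat[OF w'(2)] assms(2) 1(1) by (metis Un_iff set_append)
  with 1 w' that show thesis by simp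
qed

text \<open>Words at level \<open>k\<close> have length at most \<open>2 ^ k\<close>. So inside a block of this length, after removing the incomplete
  words at both ends, at least three periods are left that are a concatenation of complete words of level \<open>k\<close>.\<close>
lemma long_periodic_block_not_in_word:
  assumes per: "\<And>n. s (n + int p) = s n" and "0 < p" and "s u = letter_a" "s v = letter_b"
  shows "word \<xi> x y \<noteq> q @ block s 0 (3 * p + 2 * 2 ^ (2 * p * p + 1)) @ r"
proof
  define k where "k = 2 * p * p + 1"
  define w where "w = block s 0 (3 * p + 2 * 2 ^ k)"
  define f where "f = (\<lambda>i. word \<xi> i (k - i))"
  assume "word \<xi> x y = q @ block s 0 (3 * p + 2 * 2 ^ (2 * p * p + 1)) @ r"
  then have eq: "word \<xi> x y = q @ w @ r" by (simp add: w_def k_def)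
  have lw: "length w = 3 * p + 2 * 2 ^ k" by (simp add: w_def length_block)
  have k2: "2 \<le> k" using \<open>0 < p\<close> by (simp add: k_def)
  have "2 ^ k < length w" using \<open>0 < p\<close> by (simp add: lw)
  also have "length w \<le> length (word \<xi> x y)" by (simp add: eq)
  also have "\<dots> \<le> 2 ^ (x + y)" by (simp add: length_word binomial_le_pow2)
  finally have kxy: "k \<le> x + y" by simp
  have fk: "length (f i) \<le> 2 ^ k" if "i \<in> set (level_word \<xi> k x y)" for i
    using level_word_le[OF kxy that] binomial_le_pow2[of k i] by (simp add: f_def length_word)
  have "concat (map f (level_word \<xi> k x y)) = q @ w @ r"
    using word_eq_concat_level_word[of k x y \<xi>] kxy k2 eq by (simp add: f_def)
  then obtain d1 d2 d3 p' q' where d: "level_word \<xi> k x y = d1 @ d2 @ d3"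
    and w: "w = p' @ concat (map f d2) @ q'" and len: "length p' \<le> 2 ^ k" "length q' \<le> 2 ^ k"
    by (rule infix_of_concat[OF _ fk]) (simp_all add: lw)
  define t where "t = int (length p')"
  have ext: "i = 0 \<or> i = k" if i: "i \<in> set d2" for i
  proof (rule ccontr)
    assume "\<not> (i = 0 \<or> i = k)"
    moreover have "i \<le> k" using level_word_le[OF kxy, of i \<xi>] i d by simp
    ultimately have "0 < i" "0 < k - i" "i + (k - i) = 2 * p * p + 1" by (simp_all add: k_def)
    moreover obtain e1 e2 where "d2 = e1 @ i # e2" using i by (meson split_list)
    then have "block s 0 (3 * p + 2 * 2 ^ k) = (p' @ concat (map f e1)) @ f i @ (concat (map f e2) @ q')"
      using w by (simp add: w_def)
    from block_infix[OF this] have "f i = block s (int (length (p' @ concat (map f e1)))) (length (f i))"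
      by simp
    ultimately show False
      using word_not_periodic_block[where s = s and p = p, OF per assms(2-4), of i "k - i" \<xi>] unfolding f_def by metis
  qed
  have "concat (map f d2) = map (\<lambda>i. if i = 0 then letter_b else letter_a) d2"
  proof -
    have "f i = [if i = 0 then letter_b else letter_a]" if "i \<in> set d2" for i
      using ext[OF that] k2 by (cases "i = 0") (simp_all add: f_def word_0_left)
    then have "map f d2 = map (\<lambda>i. [if i = 0 then letter_b else letter_a]) d2" by simp
    then show ?thesis by (simp only: concat_map_singleton)
  qed
  moreover have "concat (map f d2) = block s t (length (concat (map f d2)))"
    using block_infix[of s 0 _ p' "concat (map f d2)" q'] w by (simp add: w_def t_def)
  ultimately have d2: "map (\<lambda>i. if i = 0 then letter_b else letter_a) d2 = block s t (length d2)"
    by (metis length_map)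
  have "length w = length p' + length d2 + length q'"
    using w \<open>concat (map f d2) = map _ d2\<close> by simp
  then have long: "3 * p \<le> length d2" using lw len by linarith
  have nth: "d2 ! i = (if s (t + int i) = letter_b then 0 else k)" if i: "i < length d2" for i
  proof -
    have "(if d2 ! i = 0 then letter_b else letter_a) = s (t + int i)"
      using arg_cong[OF d2, of "\<lambda>l. l ! i"] i by (simp add: block_def)
    then show ?thesis using ext[OF nth_mem[OF i]] k2 by (auto split: if_splits)
  qed
  \<comment> \<open>The offset, within any period counted from \<open>t\<close>, at which the letter \<open>s z\<close> recurs. The positions \<open>i\<close>, \<open>j\<close>, \<open>l\<close> below carry \<open>b\<close>, \<open>a\<close>, \<open>b\<close> in the first three periods.\<close>
  define g where "g z = nat ((z - t) mod int p)" for z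
  have g: "g z < p" "s (t + int (c * p + g z)) = s z" for z c
  proof -
    show "g z < p" using \<open>0 < p\<close> by (simp add: g_def nat_less_iff)
    have "z - t = (z - t) div int p * int p + int (g z)"
      using \<open>0 < p\<close> by (simp add: g_def)
    then have "t + int (c * p + g z) = z + (int c - (z - t) div int p) * int p"
      by (simp add: algebra_simps)
    then show "s (t + int (c * p + g z)) = s z" using periodic_add_multiple[of s "int p", OF per] by metis
  qed
  define i j l where "i = 0 * p + g v" and "j = 1 * p + g u" and "l = 2 * p + g v"
  have ijl: "i < j" "j < l" "l < length d2"
    using g(1)[of u] g(1)[of v] long by (simp_all add: i_def j_def l_def)
  have "d2 ! i = 0" "d2 ! j = k" "d2 ! l = 0"
    using ijl nth[of i] nth[of j] nth[of l] g(2)[of 0 v] g(2)[of 1 u] g(2)[of 2 v] assms(3,4)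
    unfolding i_def j_def l_def by simp_all
  moreover have at: "level_word \<xi> k x y ! (length d1 + n) = d2 ! n" if "n < length d2" for n
    using that d by (simp add: nth_append)
  ultimately have "length d1 + i < length d1 + j \<and> length d1 + j < length d1 + l \<and>
      length d1 + l < length (level_word \<xi> k x y) \<and> level_word \<xi> k x y ! (length d1 + i) = 0 \<and>
      level_word \<xi> k x y ! (length d1 + j) = k \<and> level_word \<xi> k x y ! (length d1 + l) = 0"
    using ijl by (simp add: d)
  then obtain m where m: "length d1 + i < m" "m < length d1 + l"
      "0 < level_word \<xi> k x y ! m" "level_word \<xi> k x y ! m < k"
    using level_word_interior_between[OF k2 kxy, of \<xi>] unfolding interior_between_def by blast
  then have "d2 ! (m - length d1) \<in> set d2" "level_word \<xi> k x y ! m = d2 ! (m - length d1)"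
    using at[of "m - length d1"] ijl by simp_all
  then show False using ext m(3,4) by fastforce
qed


section \<open>The two fixed points\<close>

text \<open>With every edge from the left smaller, the words next to the axes contain arbitrarily long runs of each letter.\<close>
lemma word_next_to_axes:
  "word (\<lambda>_. True) x (Suc 0) = letter_b # replicate x letter_a"
  "word (\<lambda>_. True) (Suc 0) y = replicate y letter_b @ [letter_a]"
proof -
  show "word (\<lambda>_. True) x (Suc 0) = letter_b # replicate x letter_a"
    by (induction x) (simp_all add: replicate_append_same)
  show "word (\<lambda>_. True) (Suc 0) y = replicate y letter_b @ [letter_a]"
    by (induction y) simp_all
qed

lemma constant_in_subshift: "(\<lambda>_. c) \<in> subshift_of_ordering (\<lambda>_. True)"
proof -
  have block: "block (\<lambda>_. c) k n = replicate n c" for k n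
    by (simp add: block_def map_replicate_const)
  have "\<exists>\<gamma>\<in>paths. occurs_in_coding (replicate n c) (\<lambda>_. True) \<gamma>" for n
  proof (cases c)
    case letter_a
    then have "word (\<lambda>_. True) n (Suc 0) = [letter_b] @ replicate n c @ []"
      by (simp add: word_next_to_axes)
    then show ?thesis by (rule infix_imp_occurs_in_coding) simp
  next
    case letter_b
    then have "word (\<lambda>_. True) (Suc 0) n = [] @ replicate n c @ [letter_a]"
      by (simp add: word_next_to_axes)
    then show ?thesis by (rule infix_imp_occurs_in_coding) simp
  qed
  then show ?thesis by (simp add: subshift_of_ordering_def block)
qed

lemma funpow_shift: "(shift ^^ n) s = (\<lambda>i. s (i + int n))"
  by (induction n arbitrary: s) (simp_all add: funpow_swap1 shift_def add_ac)

lemma block_infix_of_word: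
  assumes "s \<in> big_subshift"
  shows "\<exists>\<xi> x y q r. word \<xi> x y = q @ block s k n @ r"
proof -
  obtain \<xi> t l m where t: "t \<in> subshift_of_ordering \<xi>" "block s k n = block t l m"
    using assms unfolding big_subshift_def language_def by blast
  then obtain \<gamma> where "\<gamma> \<in> paths" "occurs_in_coding (block s k n) \<xi> \<gamma>"
    unfolding subshift_of_ordering_def by auto
  then show ?thesis using occurs_in_coding_imp_infix by blast
qed

theorem proposition6p7:
  "periodic_points shift big_subshift = {\<lambda>_. letter_a, \<lambda>_. letter_b}"
proof (intro subset_antisym subsetI)
  fix s assume "s \<in> periodic_points shift big_subshift"
  then obtain p where s: "s \<in> big_subshift" and "0 < p" "(shift ^^ p) s = s"
    by (auto simp: periodic_points_def)
  then have per: "s (n + int p) = s n" for n by (metis funpow_shift)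
  have "\<not> (s u = letter_a \<and> s v = letter_b)" for u v
    using block_infix_of_word[OF s, of 0] long_periodic_block_not_in_word[of s p, OF per \<open>0 < p\<close>]
    by metis
  then have "(\<forall>u. s u = letter_a) \<or> (\<forall>u. s u = letter_b)" by (metis letter.exhaust)
  then show "s \<in> {\<lambda>_. letter_a, \<lambda>_. letter_b}" by auto
next
  have "(\<lambda>_. c) \<in> periodic_points shift big_subshift" for c
    using constant_in_subshift[of c]
    by (auto simp: periodic_points_def big_subshift_def language_def funpow_shift)
  then show "s \<in> periodic_points shift big_subshift" if "s \<in> {\<lambda>_. letter_a, \<lambda>_. letter_b}" for s
    using that by auto
qed

end
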